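(* The formula $p\to\Box\Diamond p$ (i.e. $\overline p\vee\Box\Diamond p$) is absolutely minimal among the $\mathsf L_\Diamond$-formulas that define the class of symmetric frames.
   Context: Fix a countably infinite set of propositional variables $P$. $\mathsf L_\Diamond$ is the set of formulas in negation normal form built from literals $p,\overline p$ ($p\in P$), $\bot$ and $\top$ using $\vee,\wedge,\Diamond,\Box$; $\neg$ and $\to$ are abbreviations via De Morgan's rules. A frame is $(W,R)$ with $W$ nonempty and $R\subseteq W\times W$. A formula is valid on a frame if true at every point under every valuation (standard Kripke semantics). A formula $\varphi$ defines a class $\mathcal F$ of frames if for every frame $\mathcal A$, $\varphi$ is valid on $\mathcal A$ iff $\mathcal A\in\mathcal F$. The complexity measures considered are: the length (number of nodes of the syntax tree, leaves included); for each symbol among $\vee,\wedge,\Diamond,\Box,\bot,\top$, the number of its occurrences; the modal depth; and the number of distinct propositional variables. Given a set $\Gamma$ of formulas and $\varphi\in\Gamma$, $\varphi$ is absolutely minimal among $\Gamma$ if $\mu(\varphi)\leq\mu(\psi)$ for all $\psi\in\Gamma$ and every one of these measures $\mu$. *)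

theory Defs
  imports Main "HOL-Library.Countable_Set"
begin

text \<open>Formulas of the basic modal language in negation normal form; the set function
  \<open>vars\<close> yields the variables occurring in a formula, positively or negatively.\<close>

datatype (vars: 'p) fm =
    Pos 'p
  | Neg 'p
  | Bot
  | Top
  | Or "'p fm" "'p fm"
  | And "'p fm" "'p fm"
  | Dia "'p fm"
  | Box "'p fm"

primrec neg :: "'p fm \<Rightarrow> 'p fm" where
  "neg (Pos p) = Neg p"
| "neg (Neg p) = Pos p"
| "neg Bot = Top"
| "neg Top = Bot"
| "neg (Or \<phi> \<psi>) = And (neg \<phi>) (neg \<psi>)"
| "neg (And \<phi> \<psi>) = Or (neg \<phi>) (neg \<psi>)"
| "neg (Dia \<phi>) = Box (neg \<phi>)"
| "neg (Box \<phi>) = Dia (neg \<phi>)"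

definition Imp :: "'p fm \<Rightarrow> 'p fm \<Rightarrow> 'p fm" where
  "Imp \<phi> \<psi> = Or (neg \<phi>) \<psi>"

type_synonym 'w frame = "'w set \<times> ('w \<times> 'w) set"

text \<open>The carrier is a set of elements of the ambient type \<open>'w\<close>, so frames of all
  sizes embeddable in \<open>'w\<close> are present.\<close>

definition frames :: "'w frame set" where
  "frames = {(W, R). W \<noteq> {} \<and> R \<subseteq> W \<times> W}"

definition symmetric_frames :: "'w frame set" where
  "symmetric_frames = {(W, R). (W, R) \<in> frames \<and> sym R}"

text \<open>Since \<open>R \<subseteq> W \<times> W\<close> in a frame, the modalities need no explicit reference to \<open>W\<close>.\<close>

primrec sat :: "('w \<times> 'w) set \<Rightarrow> ('p \<Rightarrow> 'w set) \<Rightarrow> 'w \<Rightarrow> 'p fm \<Rightarrow> bool" where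
  "sat R V w (Pos p) \<longleftrightarrow> w \<in> V p"
| "sat R V w (Neg p) \<longleftrightarrow> w \<notin> V p"
| "sat R V w Bot \<longleftrightarrow> False"
| "sat R V w Top \<longleftrightarrow> True"
| "sat R V w (Or \<phi> \<psi>) \<longleftrightarrow> sat R V w \<phi> \<or> sat R V w \<psi>"
| "sat R V w (And \<phi> \<psi>) \<longleftrightarrow> sat R V w \<phi> \<and> sat R V w \<psi>"
| "sat R V w (Dia \<phi>) \<longleftrightarrow> (\<exists>v. (w, v) \<in> R \<and> sat R V v \<phi>)"
| "sat R V w (Box \<phi>) \<longleftrightarrow> (\<forall>v. (w, v) \<in> R \<longrightarrow> sat R V v \<phi>)"

definition valid_on :: "'w frame \<Rightarrow> 'p fm \<Rightarrow> bool" where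
  "valid_on A \<phi> \<longleftrightarrow>
     (\<forall>V. (\<forall>p. V p \<subseteq> fst A) \<longrightarrow> (\<forall>w \<in> fst A. sat (snd A) V w \<phi>))"

definition defines_class :: "'p fm \<Rightarrow> 'w frame set \<Rightarrow> bool" where
  "defines_class \<phi> F \<longleftrightarrow> (\<forall>A \<in> frames. valid_on A \<phi> \<longleftrightarrow> A \<in> F)"

primrec fm_length :: "'p fm \<Rightarrow> nat" where
  "fm_length (Pos p) = 1"
| "fm_length (Neg p) = 1"
| "fm_length Bot = 1"
| "fm_length Top = 1"
| "fm_length (Or \<phi> \<psi>) = fm_length \<phi> + fm_length \<psi> + 1"
| "fm_length (And \<phi> \<psi>) = fm_length \<phi> + fm_length \<psi> + 1"
| "fm_length (Dia \<phi>) = fm_length \<phi> + 1"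
| "fm_length (Box \<phi>) = fm_length \<phi> + 1"

datatype symbol = SOr | SAnd | SDia | SBox | SBot | STop

primrec occurrences :: "symbol \<Rightarrow> 'p fm \<Rightarrow> nat" where
  "occurrences s (Pos p) = 0"
| "occurrences s (Neg p) = 0"
| "occurrences s Bot = (if s = SBot then 1 else 0)"
| "occurrences s Top = (if s = STop then 1 else 0)"
| "occurrences s (Or \<phi> \<psi>) = occurrences s \<phi> + occurrences s \<psi> + (if s = SOr then 1 else 0)"
| "occurrences s (And \<phi> \<psi>) = occurrences s \<phi> + occurrences s \<psi> + (if s = SAnd then 1 else 0)"
| "occurrences s (Dia \<phi>) = occurrences s \<phi> + (if s = SDia then 1 else 0)"
| "occurrences s (Box \<phi>) = occurrences s \<phi> + (if s = SBox then 1 else 0)"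

primrec modal_depth :: "'p fm \<Rightarrow> nat" where
  "modal_depth (Pos p) = 0"
| "modal_depth (Neg p) = 0"
| "modal_depth Bot = 0"
| "modal_depth Top = 0"
| "modal_depth (Or \<phi> \<psi>) = max (modal_depth \<phi>) (modal_depth \<psi>)"
| "modal_depth (And \<phi> \<psi>) = max (modal_depth \<phi>) (modal_depth \<psi>)"
| "modal_depth (Dia \<phi>) = modal_depth \<phi> + 1"
| "modal_depth (Box \<phi>) = modal_depth \<phi> + 1"

definition num_vars :: "'p fm \<Rightarrow> nat" where
  "num_vars \<phi> = card (vars \<phi>)"

definition complexity_measures :: "('p fm \<Rightarrow> nat) set" where
  "complexity_measures = {fm_length, modal_depth, num_vars} \<union> range occurrences"

definition absolutely_minimal :: "'p fm \<Rightarrow> 'p fm set \<Rightarrow> bool" where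
  "absolutely_minimal \<phi> \<Gamma> \<longleftrightarrow>
     \<phi> \<in> \<Gamma> \<and> (\<forall>\<mu> \<in> complexity_measures. \<forall>\<psi> \<in> \<Gamma>. \<mu> \<phi> \<le> \<mu> \<psi>)"

end

theory Submission
  imports Defs
begin

text \<open>Each lower bound transfers validity from a symmetric frame to a non-symmetric one.
  Formulas without \<open>\<box>\<close> are preserved when arrows are added, those without \<open>\<diamond>\<close> when arrows are
  removed. Variable-free formulas do not distinguish serial frames, and formulas of modal
  depth at most one do not distinguish the directed cycles of lengths two and three. On a single
  reflexive point a \<open>\<or>\<close>-free formula is a conjunction of its leaves, so if it is valid it contains
  no variable. The bound on the length follows, since one \<open>\<or>\<close> forces two leaves.\<close>

lemma defines_symmetric_Imp_Box_Dia:
  "defines_class (Imp (Pos p) (Box (Dia (Pos p)))) symmetric_frames"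
proof -
  have "valid_on (W, R) (Imp (Pos p) (Box (Dia (Pos p)))) \<longleftrightarrow> sym R"
    if R: "R \<subseteq> W \<times> W" for W :: "'w set" and R
  proof
    assume val: "valid_on (W, R) (Imp (Pos p) (Box (Dia (Pos p))))"
    show "sym R"
    proof (rule symI)
      fix x y assume xy: "(x, y) \<in> R"
      then have x: "x \<in> W" using R by auto
      \<comment> \<open>With \<open>p\<close> true at \<open>x\<close> alone, a successor
        \<open>y\<close> of \<open>x\<close> can satisfy \<open>Dia (Pos p)\<close> only by seeing
        \<open>x\<close> itself.\<close>
      then have "sat R (\<lambda>_. {x}) x (Imp (Pos p) (Box (Dia (Pos p))))"
        using val by (simp add: valid_on_def)
      then show "(y, x) \<in> R" using xy by (auto simp: Imp_def)
    qed
  qed (auto simp: valid_on_def Imp_def dest: symD)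
  then show ?thesis
    by (auto simp: defines_class_def frames_def symmetric_frames_def)
qed

lemma finite_vars: "finite (vars \<phi>)"
  by (induction \<phi>) auto

text \<open>A tree with n binary nodes has n + 1 leaves, so each disjunction costs two nodes, and
  the final 1 is the leaf left over.\<close>

lemma fm_length_ge_occurrences:
  "2 * occurrences SOr \<phi> + occurrences SDia \<phi> + occurrences SBox \<phi> + 1 \<le> fm_length \<phi>"
  by (induction \<phi>) auto

text \<open>In negation normal form no modality is negated, so the relation enters only through
  \<open>Dia\<close>, hence positively.\<close>

lemma sat_mono_of_no_Box:
  assumes "occurrences SBox \<phi> = 0" "R \<subseteq> S" "sat R V w \<phi>"
  shows "sat S V w \<phi>"
  using assms by (induction \<phi> arbitrary: w) auto

lemma sat_antimono_of_no_Dia: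
  assumes "occurrences SDia \<phi> = 0" "R \<subseteq> S" "sat S V w \<phi>"
  shows "sat R V w \<phi>"
  using assms by (induction \<phi> arbitrary: w) auto

text \<open>Letting both points vary, the induction shows that truth is constant across the
  carriers; since successors exist, \<open>Dia\<close> and \<open>Box\<close> both return that
  constant.\<close>

lemma sat_serial_of_no_vars:
  assumes "vars \<phi> = {}"
    and "R \<subseteq> W \<times> W" "\<And>w. w \<in> W \<Longrightarrow> \<exists>v. (w, v) \<in> R"
    and "R' \<subseteq> W' \<times> W'" "\<And>w. w \<in> W' \<Longrightarrow> \<exists>v. (w, v) \<in> R'"
    and "w \<in> W" "w' \<in> W'"
  shows "sat R V w \<phi> \<longleftrightarrow> sat R' V' w' \<phi>"
  using assms(1,6,7)
proof (induction \<phi> arbitrary: w w')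
  case (Dia \<phi>)
  have "sat R V v \<phi> \<longleftrightarrow> sat R' V' v' \<phi>" if "(w, v) \<in> R" "(w', v') \<in> R'" for v v'
    using that Dia assms(2,4) by (intro Dia.IH) auto
  then show ?case using assms(3)[OF Dia.prems(2)] assms(5)[OF Dia.prems(3)] by auto
next
  case (Box \<phi>)
  have "sat R V v \<phi> \<longleftrightarrow> sat R' V' v' \<phi>" if "(w, v) \<in> R" "(w', v') \<in> R'" for v v'
    using that Box assms(2,4) by (intro Box.IH) auto
  then show ?case using assms(3)[OF Box.prems(2)] assms(5)[OF Box.prems(3)] by auto
qed auto

text \<open>Validity passes to both conjuncts and through modalities at a loop, while a literal is
  refuted by the empty or the full valuation.\<close>

lemma no_vars_of_no_Or_reflexive_point:
  assumes "occurrences SOr \<phi> = 0"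
    and "\<And>V. \<forall>q. V q \<subseteq> {u} \<Longrightarrow> sat {(u, u)} V u \<phi>"
  shows "vars \<phi> = {}"
  using assms
proof (induction \<phi>)
  case (Pos q)
  from Pos(2)[of "\<lambda>_. {}"] show ?case by simp
next
  case (Neg q)
  from Neg(2)[of "\<lambda>_. {u}"] show ?case by simp
qed auto

lemma sat_cong_of_depth_0:
  assumes "modal_depth \<phi> = 0" "\<And>q. w \<in> V q \<longleftrightarrow> w' \<in> V' q"
  shows "sat R V w \<phi> \<longleftrightarrow> sat R' V' w' \<phi>"
  using assms by (induction \<phi>) auto

text \<open>Only the atoms at the point and at its unique successor matter: below a modality the
  depth is 0, and further arrows are invisible.\<close>

lemma sat_cong_of_depth_1:
  assumes "modal_depth \<phi> \<le> 1"
    and "\<And>q. w \<in> V q \<longleftrightarrow> w' \<in> V' q" "\<And>q. v \<in> V q \<longleftrightarrow> v' \<in> V' q"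
    and "\<And>x. (w, x) \<in> R \<longleftrightarrow> x = v" "\<And>x. (w', x) \<in> R' \<longleftrightarrow> x = v'"
  shows "sat R V w \<phi> \<longleftrightarrow> sat R' V' w' \<phi>"
  using assms(1)
proof (induction \<phi>)
  case (Dia \<phi>)
  then show ?case using sat_cong_of_depth_0[of \<phi> v V v' V' R R'] assms(3-5) by simp
next
  case (Box \<phi>)
  then show ?case using sat_cong_of_depth_0[of \<phi> v V v' V' R R'] assms(3-5) by simp
qed (use assms(2) in auto)

text \<open>The three points carry the test frames; only the three-cycle for modal depth uses all of
  them.\<close>

locale symmetry_formula =
  fixes \<psi> :: "'p fm" and a b c :: 'w
  assumes characterizes: "defines_class \<psi> (symmetric_frames :: 'w frame set)"
    and distinct: "a \<noteq> b" "a \<noteq> c" "b \<noteq> c"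
begin

lemma valid_on_iff_sym:
  fixes W :: "'w set"
  assumes "R \<subseteq> W \<times> W" "W \<noteq> {}"
  shows "valid_on (W, R) \<psi> \<longleftrightarrow> sym R"
proof -
  have "(W, R) \<in> frames" using assms by (simp add: frames_def)
  then show ?thesis
    using characterizes by (simp add: defines_class_def symmetric_frames_def)
qed

lemma sat_if_sym:
  fixes W :: "'w set"
  assumes "sym R" "R \<subseteq> W \<times> W" "w \<in> W" "\<And>q. V q \<subseteq> W"
  shows "sat R V w \<psi>"
proof -
  have "valid_on (W, R) \<psi>" using assms valid_on_iff_sym[of R W] by blast
  then show ?thesis using assms by (simp add: valid_on_def)
qed

lemma refuted_if_not_sym:
  fixes W :: "'w set"
  assumes "\<not> sym R" "R \<subseteq> W \<times> W"
  obtains V w where "\<And>q. V q \<subseteq> W" "w \<in> W" "\<not> sat R V w \<psi>"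
proof -
  have "W \<noteq> {}" using assms by (auto simp: sym_def)
  then have "\<not> valid_on (W, R) \<psi>" using assms valid_on_iff_sym[of R W] by blast
  then show ?thesis using that by (auto simp: valid_on_def)
qed

lemma occurrences_Box: "occurrences SBox \<psi> \<noteq> 0"
proof
  assume 0: "occurrences SBox \<psi> = 0"
  have "\<not> sym {(a, b)}" using distinct by (auto simp: sym_def)
  then obtain V w where "\<And>q. V q \<subseteq> {a, b}" "w \<in> {a, b}" "\<not> sat {(a, b)} V w \<psi>"
    by (rule refuted_if_not_sym[where W = "{a, b}"]) auto
  \<comment> \<open>The empty relation is symmetric, so \<open>\<psi>\<close> holds there under the
    same valuation and survives adding the arrow.\<close>
  then show False
    using sat_if_sym[of "{}" "{a, b}" w V] sat_mono_of_no_Box[OF 0, of "{}" "{(a, b)}"]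
    by (auto simp: sym_def)
qed

lemma occurrences_Dia: "occurrences SDia \<psi> \<noteq> 0"
proof
  assume 0: "occurrences SDia \<psi> = 0"
  have "\<not> sym {(a, b)}" using distinct by (auto simp: sym_def)
  then obtain V w where "\<And>q. V q \<subseteq> {a, b}" "w \<in> {a, b}" "\<not> sat {(a, b)} V w \<psi>"
    by (rule refuted_if_not_sym[where W = "{a, b}"]) auto
  \<comment> \<open>Here the symmetric frame is the larger one: removing the arrow back from
    \<open>b\<close> to \<open>a\<close> preserves \<open>\<psi>\<close>.\<close>
  then show False
    using sat_if_sym[of "{(a, b), (b, a)}" "{a, b}" w V]
      sat_antimono_of_no_Dia[OF 0, of "{(a, b)}" "{(a, b), (b, a)}"]
    by (auto simp: sym_def)
qed

lemma vars_nonempty: "vars \<psi> \<noteq> {}"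
proof
  assume 0: "vars \<psi> = {}"
  \<comment> \<open>The loop at \<open>b\<close> makes this asymmetric example serial, hence
    comparable with a single reflexive point.\<close>
  have "\<not> sym {(a, b), (b, b)}" using distinct by (auto simp: sym_def)
  then obtain V w where "w \<in> {a, b}" "\<not> sat {(a, b), (b, b)} V w \<psi>"
    by (rule refuted_if_not_sym[where W = "{a, b}"]) auto
  moreover have "sat {(b, b)} (\<lambda>_. {}) b \<psi>"
    by (rule sat_if_sym[where W = "{b}"]) (auto simp: sym_def)
  moreover have "sat {(a, b), (b, b)} V w \<psi> \<longleftrightarrow> sat {(b, b)} (\<lambda>_. {}) b \<psi>"
    by (rule sat_serial_of_no_vars[OF 0, where W = "{a, b}" and W' = "{b}"])
      (use \<open>w \<in> {a, b}\<close> in auto)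
  ultimately show False by simp
qed

lemma occurrences_Or: "occurrences SOr \<psi> \<noteq> 0"
proof
  assume "occurrences SOr \<psi> = 0"
  then have "vars \<psi> = {}"
    by (rule no_vars_of_no_Or_reflexive_point[where u = a])
      (rule sat_if_sym[where W = "{a}"], auto simp: sym_def)
  then show False using vars_nonempty by simp
qed

lemma modal_depth_ge_2: "2 \<le> modal_depth \<psi>"
proof (rule ccontr)
  assume "\<not> 2 \<le> modal_depth \<psi>"
  then have depth: "modal_depth \<psi> \<le> 1" by simp
  let ?R = "{(a, b), (b, c), (c, a)}"
  have "\<not> sym ?R" using distinct by (auto simp: sym_def)
  then obtain V w where w: "w \<in> {a, b, c}" and unsat: "\<not> sat ?R V w \<psi>"
    by (rule refuted_if_not_sym[where W = "{a, b, c}"]) auto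
  obtain v where v: "\<And>x. (w, x) \<in> ?R \<longleftrightarrow> x = v"
    using w distinct by auto
  \<comment> \<open>\<open>?V\<close> copies the atoms of \<open>w\<close> to \<open>a\<close> and
    those of its successor \<open>v\<close> to \<open>b\<close>; the copies do not clash because
    \<open>a\<close> and \<open>b\<close> differ.\<close>
  let ?V = "\<lambda>q. (if w \<in> V q then {a} else {}) \<union> (if v \<in> V q then {b} else {})"
  have "sat ?R V w \<psi> \<longleftrightarrow> sat {(a, b), (b, a)} ?V a \<psi>"
    by (rule sat_cong_of_depth_1[OF depth _ _ v, where v' = b]) (use distinct in auto)
  moreover have "sat {(a, b), (b, a)} ?V a \<psi>"
    by (rule sat_if_sym[where W = "{a, b}"]) (auto simp: sym_def)
  ultimately show False using unsat by simp
qed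

end

theorem theorem9p3:
  fixes p :: 'p
  assumes "countable (UNIV :: 'p set)" and "infinite (UNIV :: 'p set)"
    and "infinite (UNIV :: 'w set)"
  shows "absolutely_minimal (Imp (Pos p) (Box (Dia (Pos p))))
           {\<psi> :: 'p fm. defines_class \<psi> (symmetric_frames :: 'w frame set)}"
proof -
  obtain T :: "'w set" where "card T = 3"
    using infinite_arbitrarily_large[OF assms(3)] by blast
  then obtain a b c :: 'w where abc: "a \<noteq> b" "a \<noteq> c" "b \<noteq> c"
    by (auto simp: card_3_iff)
  let ?\<phi> = "Imp (Pos p) (Box (Dia (Pos p)))"
  have "\<mu> ?\<phi> \<le> \<mu> \<psi>"
    if \<mu>: "\<mu> \<in> complexity_measures"
      and \<psi>: "defines_class \<psi> (symmetric_frames :: 'w frame set)" for \<mu> and \<psi> :: "'p fm"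
  proof -
    interpret symmetry_formula \<psi> a b c
      using \<psi> abc by unfold_locales
    have "0 < card (vars \<psi>)"
      using vars_nonempty finite_vars by (simp add: card_gt_0_iff)
    then have num_vars: "num_vars ?\<phi> \<le> num_vars \<psi>"
      by (simp add: num_vars_def Imp_def)
    \<comment> \<open>One disjunction, one diamond and one box force at least 2 + 1 + 1 + 1 = 5
      nodes, exactly the length of \<open>?\<phi>\<close>.\<close>
    have length: "fm_length ?\<phi> \<le> fm_length \<psi>"
      using fm_length_ge_occurrences[of \<psi>] occurrences_Or occurrences_Dia occurrences_Box
      by (simp add: Imp_def)
    have depth: "modal_depth ?\<phi> \<le> modal_depth \<psi>"
      using modal_depth_ge_2 by (simp add: Imp_def)
    have "occurrences s ?\<phi> \<le> occurrences s \<psi>" for s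
      using occurrences_Or occurrences_Dia occurrences_Box by (cases s) (auto simp: Imp_def)
    with num_vars length depth \<mu> show ?thesis
      by (auto simp: complexity_measures_def)
  qed
  then show ?thesis
    using defines_symmetric_Imp_Box_Dia by (auto simp: absolutely_minimal_def)
qed

end
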